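(* Let $K\subset\mathbb{H}^n$, $n\ge2$, be a convex body. Then $$\mathrm{diam}\,K=\max\{w_F(K,i) : i\text{ is an ideal point}\}.$$
   Context: $\mathbb{H}^n$ is $n$-dimensional hyperbolic space with its geodesic distance. A convex body is a compact (geodesically) convex set with non-empty interior. Fillmore width: a horosphere $\partial A$ (boundary of a horoball $A$) supports $K$ if $\partial A\cap\partial K\ne\emptyset$ and either $K\subset A$ or $K\subset\mathbb{H}^n\setminus\mathrm{int}\,A$. For each ideal point $i$ there are exactly two supporting horospheres of $K$ centred at $i$; $w_F(K,i)$ is the distance between them, i.e. the length of the segment they cut out of any line having $i$ as an ideal point. *)

theory Defs
  imports "HOL-Analysis.Analysis" "HOL-Real_Asymp.Real_Asymp"
begin

section \<open>Hyperbolic space (hyperboloid model)\<close>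

text \<open>
  Vectors of Minkowski space are pairs of a space part in the Euclidean space \<^typ>\<open>'a\<close> and a
  time part. The sign is chosen so that future timelike vectors have positive products.
\<close>

definition mink :: "'a::euclidean_space \<times> real \<Rightarrow> 'a \<times> real \<Rightarrow> real" where
  "mink p q = snd p * snd q - fst p \<bullet> fst q"

text \<open>The upper sheet of the hyperboloid; its dimension is that of \<^typ>\<open>'a\<close>.\<close>

typedef (overloaded) 'a hyperbolic = "{p :: 'a::euclidean_space \<times> real. mink p p = 1 \<and> snd p > 0}"
  morphisms hvec Abs_hyperbolic
  by (rule exI[of _ "(0, 1)"]) (simp add: mink_def)

lemma mink_vec_self: "mink (hvec p) (hvec p) = 1"
  using hvec[of p] by simp

lemma hvec_future: "snd (hvec p) > 0"
  using hvec[of p] by simp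

lemma mink_commute: "mink p q = mink q p"
  by (simp add: mink_def inner_commute mult.commute)

lemma mink_self: "mink v v = (snd v)\<^sup>2 - (norm (fst v))\<^sup>2"
  by (simp only: mink_def power2_norm_eq_inner) (simp only: power2_eq_square)

lemma norm_less_time: "norm (fst (hvec p)) < snd (hvec p)"
proof -
  have "(norm (fst (hvec p)))\<^sup>2 < (snd (hvec p))\<^sup>2"
    using mink_vec_self[of p] by (simp only: mink_self)
  then show ?thesis
    using hvec_future[of p] by (meson less_eq_real_def power_less_imp_less_base)
qed

lemma mink_vec_ge_1: "mink (hvec p) (hvec q) \<ge> 1"
  and mink_vec_eq_1: "mink (hvec p) (hvec q) = 1 \<longleftrightarrow> p = q"
proof -
  define x y where xy: "x = fst (hvec p)" "y = fst (hvec q)"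
  define t s where ts: "t = snd (hvec p)" "s = snd (hvec q)"
  have t: "t\<^sup>2 = 1 + (norm x)\<^sup>2" "s\<^sup>2 = 1 + (norm y)\<^sup>2" "t > 0" "s > 0"
    using mink_vec_self[of p] mink_vec_self[of q] hvec_future[of p] hvec_future[of q] unfolding xy ts
    by (simp_all add: mink_self algebra_simps)
  have cs: "x \<bullet> y \<le> norm x * norm y"
    by (rule norm_cauchy_schwarz)
  have sq: "(t * s)\<^sup>2 = (1 + norm x * norm y)\<^sup>2 + (norm x - norm y)\<^sup>2"
    by (simp add: power_mult_distrib t(1,2)) (simp add: power2_eq_square algebra_simps)
  have le: "1 + norm x * norm y \<le> t * s"
    by (rule power2_le_imp_le) (use sq t in auto)
  show "mink (hvec p) (hvec q) \<ge> 1"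
    using cs le by (simp add: mink_def xy ts)
  show "mink (hvec p) (hvec q) = 1 \<longleftrightarrow> p = q"
  proof
    assume "mink (hvec p) (hvec q) = 1"
    then have *: "t * s - x \<bullet> y = 1"
      by (simp add: mink_def xy ts)
    then have ts1: "t * s = 1 + norm x * norm y" and in1: "x \<bullet> y = norm x * norm y"
      using cs le by linarith+
    then have "norm x = norm y"
      using sq by simp
    then have "(x - y) \<bullet> (x - y) = 0"
      using in1 unfolding inner_diff
      by (simp add: inner_commute[of y x] dot_square_norm power2_eq_square del: inner_eq_zero_iff)
    then have "x = y"
      by simp
    moreover from \<open>norm x = norm y\<close> have "t = s"
      using t by (metis less_eq_real_def power2_eq_imp_eq)
    ultimately have "hvec p = hvec q"
      by (simp add: xy ts prod_eq_iff)
    then show "p = q"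
      by (simp add: hvec_inject)
  qed (simp add: mink_vec_self)
qed

lemma null_future:
  assumes "mink v v = 0" "mink v (hvec p) \<ge> 0"
  shows "norm (fst v) = snd v"
proof -
  have "(norm (fst v))\<^sup>2 = (snd v)\<^sup>2"
    using assms(1) by (simp add: mink_self)
  then have eq: "norm (fst v) = \<bar>snd v\<bar>"
    by (metis abs_norm_cancel power2_abs real_sqrt_abs)
  have "snd v \<ge> 0"
  proof (rule ccontr)
    assume neg: "\<not> snd v \<ge> 0"
    have "- (fst v \<bullet> fst (hvec p)) \<le> norm (fst v) * norm (fst (hvec p))"
      using norm_cauchy_schwarz[of "- fst v" "fst (hvec p)"] by simp
    also have "\<dots> < \<bar>snd v\<bar> * snd (hvec p)"
      using norm_less_time[of p] neg by (simp add: eq)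
    finally show False
      using assms(2) neg by (simp add: mink_def)
  qed
  then show ?thesis
    using eq by simp
qed

lemma mink_null_null:
  assumes "norm (fst v) = snd v" "norm (fst w) = snd w"
  shows "mink v w \<ge> 0"
  using norm_cauchy_schwarz[of "fst v" "fst w"] assms by (simp add: mink_def)

lemma mink_linear:
  "mink (c *\<^sub>R u + d *\<^sub>R v) w = c * mink u w + d * mink v w"
  "mink w (c *\<^sub>R u + d *\<^sub>R v) = c * mink w u + d * mink w v"
  by (simp_all add: mink_def algebra_simps inner_add inner_scaleR)

lemma mink_triangle:
  "mink (hvec q) (hvec r) \<le> cosh (arcosh (mink (hvec q) (hvec p)) + arcosh (mink (hvec p) (hvec r)))"
proof -
  define a b where ab: "a = arcosh (mink (hvec q) (hvec p))" "b = arcosh (mink (hvec p) (hvec r))"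
  have nn: "a \<ge> 0" "b \<ge> 0"
    unfolding ab by (simp_all add: mink_vec_ge_1)
  have qp: "mink (hvec q) (hvec p) = cosh a" and pr: "mink (hvec p) (hvec r) = cosh b"
    unfolding ab by (simp_all add: mink_vec_ge_1)
  note pq = qp[unfolded mink_commute[of "hvec q"]] 
  note rp = pr[unfolded mink_commute[of "hvec p"]]
  define v where "v = exp a *\<^sub>R hvec p + (-1) *\<^sub>R hvec q"
  define w where "w = 1 *\<^sub>R hvec r + (- exp (- b)) *\<^sub>R hvec p"
  note ex = cosh_def sinh_def exp_minus exp_add exp_diff field_simps power2_eq_square
  have v: "norm (fst v) = snd v"
  proof (rule null_future[of _ p])
    show "mink v v = 0"
      unfolding v_def mink_linear mink_vec_self qp pq by (simp add: ex)
    have "mink v (hvec p) = sinh a"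
      unfolding v_def mink_linear mink_vec_self qp by (simp add: ex)
    then show "mink v (hvec p) \<ge> 0"
      using nn by simp
  qed
  have w: "norm (fst w) = snd w"
  proof (rule null_future[of _ p])
    show "mink w w = 0"
      unfolding w_def mink_linear mink_vec_self pr rp by (simp add: ex)
    have "mink w (hvec p) = sinh b"
      unfolding w_def mink_linear mink_vec_self rp by (simp add: ex)
    then show "mink w (hvec p) \<ge> 0"
      using nn by simp
  qed
  have "mink v w = cosh (a + b) - mink (hvec q) (hvec r)"
    unfolding v_def w_def mink_linear mink_vec_self pr qp by (simp add: ex)
  then show ?thesis
    using mink_null_null[OF v w] by (simp add: ab)
qed

instantiation hyperbolic :: (euclidean_space) metric_space
begin

definition dist_hyperbolic :: "'a hyperbolic \<Rightarrow> 'a hyperbolic \<Rightarrow> real" where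
  "dist_hyperbolic p q = arcosh (mink (hvec p) (hvec q))"

definition uniformity_hyperbolic :: "('a hyperbolic \<times> 'a hyperbolic) filter" where
  "uniformity_hyperbolic = (INF e\<in>{0<..}. principal {(x, y). dist x y < e})"

definition open_hyperbolic :: "'a hyperbolic set \<Rightarrow> bool" where
  "open_hyperbolic U \<longleftrightarrow> (\<forall>x\<in>U. eventually (\<lambda>(x', y). x' = x \<longrightarrow> y \<in> U) uniformity)"

instance
proof
  fix p q r :: "'a hyperbolic"
  show "dist p q = 0 \<longleftrightarrow> p = q"
    by (simp add: dist_hyperbolic_def mink_vec_ge_1 mink_vec_eq_1)
  have "dist p q = arcosh (mink (hvec p) (hvec q))"
    by (simp add: dist_hyperbolic_def)
  also have "\<dots> \<le> arcosh (cosh (dist p r + dist r q))"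
    using mink_triangle[of p q r] mink_vec_ge_1[of p q]
    by (simp add: dist_hyperbolic_def le_less)
       (metis arcosh_real_strict_mono order_le_less)
  also have "\<dots> = dist p r + dist r q"
    by (rule arcosh_cosh_real) (simp add: dist_hyperbolic_def mink_vec_ge_1)
  finally show "dist p q \<le> dist p r + dist q r"
    by (simp add: dist_hyperbolic_def mink_commute)
qed (fact uniformity_hyperbolic_def open_hyperbolic_def)+

end

definition geodesic_path :: "real \<Rightarrow> (real \<Rightarrow> 'a::metric_space) \<Rightarrow> bool" where
  "geodesic_path L \<gamma> \<longleftrightarrow> (\<forall>s\<in>{0..L}. \<forall>t\<in>{0..L}. dist (\<gamma> s) (\<gamma> t) = \<bar>s - t\<bar>)"

definition geodesically_convex :: "'a::metric_space set \<Rightarrow> bool" where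
  "geodesically_convex K \<longleftrightarrow>
     (\<forall>L \<ge> 0. \<forall>\<gamma>. geodesic_path L \<gamma> \<and> \<gamma> 0 \<in> K \<and> \<gamma> L \<in> K \<longrightarrow> \<gamma> ` {0..L} \<subseteq> K)"

definition convex_body :: "'a::euclidean_space hyperbolic set \<Rightarrow> bool" where
  "convex_body K \<longleftrightarrow> compact K \<and> geodesically_convex K \<and> interior K \<noteq> {}"


section \<open>Ideal points and horoballs\<close>

text \<open>
  Every asymptoty class of geodesic rays contains exactly one ray issuing from the base point
  \<open>(0, 1)\<close>, so ideal points are represented by the unit initial directions of these rays.
  Equivalently, \<open>i\<close> stands for the future null direction spanned by \<open>(i, 1)\<close>.
\<close>

definition ideal_points :: "'a::euclidean_space set" where
  "ideal_points = sphere 0 1"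

definition ideal_ray :: "'a::euclidean_space \<Rightarrow> real \<Rightarrow> 'a hyperbolic" where
  "ideal_ray i t = Abs_hyperbolic (sinh t *\<^sub>R i, cosh t)"

definition busemann :: "'a::euclidean_space \<Rightarrow> 'a hyperbolic \<Rightarrow> real" where
  "busemann i p = Lim at_top (\<lambda>t. dist p (ideal_ray i t) - t)"

definition horoball_at :: "'a::euclidean_space \<Rightarrow> 'a hyperbolic set \<Rightarrow> bool" where
  "horoball_at i A \<longleftrightarrow> (\<exists>c. A = {p. busemann i p \<le> c})"

lemma hvec_ideal_ray:
  assumes "i \<in> ideal_points"
  shows "hvec (ideal_ray i t) = (sinh t *\<^sub>R i, cosh t)"
proof -
  have "i \<bullet> i = 1"
    using assms by (simp add: ideal_points_def norm_eq_1)
  then have "mink (sinh t *\<^sub>R i, cosh t) (sinh t *\<^sub>R i, cosh t) = 1"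
    using cosh_square_eq[of t] by (simp add: mink_def power2_eq_square)
  then show ?thesis
    unfolding ideal_ray_def by (intro Abs_hyperbolic_inverse) (simp add: cosh_real_pos)
qed

lemma dist_ideal_ray:
  assumes "i \<in> ideal_points"
  shows "dist (ideal_ray i s) (ideal_ray i t) = \<bar>s - t\<bar>"
proof -
  have "i \<bullet> i = 1"
    using assms by (simp add: ideal_points_def norm_eq_1)
  then have "dist (ideal_ray i s) (ideal_ray i t) = arcosh (cosh \<bar>s - t\<bar>)"
    by (simp add: dist_hyperbolic_def hvec_ideal_ray[OF assms] mink_def cosh_diff mult.commute)
  then show ?thesis
    by (simp only: arcosh_cosh_real abs_ge_zero)
qed

lemma tendsto_busemann:
  assumes "i \<in> ideal_points"
  shows "((\<lambda>t. dist p (ideal_ray i t) - t) \<longlongrightarrow> ln (mink (hvec p) (i, 1))) at_top"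
proof -
  define T c where Tc: "T = snd (hvec p)" "c = fst (hvec p) \<bullet> i"
  define y where "y = (\<lambda>t. T * cosh t - c * sinh t)"
  have "c \<le> norm (fst (hvec p))"
    using norm_cauchy_schwarz[of "fst (hvec p)" i] assms by (simp add: Tc ideal_points_def)
  then have pos: "T - c > 0"
    using norm_less_time[of p] by (simp add: Tc)
  have y: "mink (hvec p) (hvec (ideal_ray i t)) = y t" for t
    by (simp add: hvec_ideal_ray[OF assms] mink_def y_def Tc mult.commute)
  have y1: "y t \<ge> 1" for t
    using mink_vec_ge_1[of p "ideal_ray i t"] by (simp add: y)
  have eq: "dist p (ideal_ray i t) - t = ln (y t * exp (- t) + sqrt ((y t * exp (- t))\<^sup>2 - exp (- t)^2))"
    for t
  proof -
    have "y t + sqrt ((y t)\<^sup>2 - 1) > 0"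
      using y1[of t] by (intro add_pos_nonneg) auto
    then have "dist p (ideal_ray i t) - t = ln ((y t + sqrt ((y t)\<^sup>2 - 1)) * exp (- t))"
      using y1[of t] by (simp add: dist_hyperbolic_def y arcosh_real_def ln_mult)
    also have "(y t + sqrt ((y t)\<^sup>2 - 1)) * exp (- t)
        = y t * exp (- t) + sqrt (((y t)\<^sup>2 - 1) * exp (- t)^2)"
      by (simp add: real_sqrt_mult distrib_right)
    also have "((y t)\<^sup>2 - 1) * exp (- t)^2 = (y t * exp (- t))\<^sup>2 - exp (- t)^2"
      by (simp add: algebra_simps power_mult_distrib)
    finally show ?thesis .
  qed
  have e: "((\<lambda>t::real. exp (- t)) \<longlongrightarrow> 0) at_top"
    by real_asymp
  have "y t * exp (- t) = (T - c) / 2 + (T + c) / 2 * exp (- t)^2" for t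
    by (simp add: y_def cosh_def sinh_def exp_minus field_simps power2_eq_square)
  then have "((\<lambda>t. y t * exp (- t)) \<longlongrightarrow> (T - c) / 2 + (T + c) / 2 * 0^2) at_top"
    by (simp only:) (intro tendsto_intros e)
  then have lim: "((\<lambda>t. y t * exp (- t)) \<longlongrightarrow> (T - c) / 2) at_top"
    by simp
  have "((\<lambda>t. ln (y t * exp (- t) + sqrt ((y t * exp (- t))\<^sup>2 - exp (- t)^2)))
          \<longlongrightarrow> ln ((T - c) / 2 + sqrt (((T - c) / 2)\<^sup>2 - 0^2))) at_top"
    using pos by (intro tendsto_intros lim e) (simp add: add_pos_nonneg less_imp_neq[symmetric])
  moreover have "(T - c) / 2 + sqrt (((T - c) / 2)\<^sup>2 - 0^2) = mink (hvec p) (i, 1)"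
    using pos by (simp add: mink_def Tc del: power_divide)
  ultimately show ?thesis
    by (simp add: eq)
qed

lemma busemann_eq:
  assumes "i \<in> ideal_points"
  shows "busemann i p = ln (mink (hvec p) (i, 1))"
  unfolding busemann_def by (rule tendsto_Lim[OF _ tendsto_busemann[OF assms]]) simp


section \<open>Fillmore width\<close>

definition supporting_horospheres ::
    "'a::euclidean_space hyperbolic set \<Rightarrow> 'a \<Rightarrow> 'a hyperbolic set set" where
  "supporting_horospheres K i =
     {frontier A | A. horoball_at i A \<and> frontier A \<inter> frontier K \<noteq> {} \<and>
        (K \<subseteq> A \<or> K \<subseteq> - interior A)}"

text \<open>The description operator is meaningful where there are exactly two supporting horospheres.\<close>

definition fillmore_width :: "'a::euclidean_space hyperbolic set \<Rightarrow> 'a \<Rightarrow> real" where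
  "fillmore_width K i =
     (THE w. \<exists>S T. supporting_horospheres K i = {S, T} \<and> S \<noteq> T \<and> w = setdist S T)"

end

theory Submission
  imports Defs
begin

text \<open>
  The Busemann function \<open>b\<close> of an ideal point \<open>i\<close> is 1-Lipschitz, and following the line from a
  point \<open>p\<close> towards \<open>i\<close> decreases it at unit speed (\<open>horo_flow\<close>). The horospheres centred at \<open>i\<close>
  are therefore the level sets of \<open>b\<close>, any two of them, \<open>b = x\<close> and \<open>b = y\<close>, are at
  distance \<open>\<bar>x - y\<bar>\<close>, and \<open>b\<close> has no local extremum. Hence those that support a convex body \<open>K\<close>
  belong to the maximum and the minimum of \<open>b\<close> on \<open>K\<close>, and the Fillmore width is the oscillation of
  \<open>b\<close> on \<open>K\<close> (\<open>fillmore_width_eq\<close>).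

  By the Lipschitz property this is at most the diameter. Conversely, let \<open>p\<close> and \<open>q\<close> be points of
  \<open>K\<close> that realise the diameter, and let \<open>i\<close> be the end of the ray from \<open>p\<close> through \<open>q\<close>. Then \<open>b\<close>
  decreases by exactly \<open>dist p q\<close> from \<open>p\<close> to \<open>q\<close> (\<open>ex_ideal_point_busemann_diff\<close>), so that the
  oscillation for this \<open>i\<close> is at least the diameter.
\<close>

section \<open>Busemann functions and the flow towards an ideal point\<close>

lemma mink_ideal_pos:
  assumes "i \<in> ideal_points"
  shows "mink (hvec p) (i, 1) > 0"
  using norm_cauchy_schwarz[of "fst (hvec p)" i] norm_less_time[of p] assms
  by (simp add: mink_def ideal_points_def)

lemma mink_ideal_self:
  assumes "i \<in> ideal_points"
  shows "mink (i, 1) (i, 1) = 0"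
  using assms by (simp add: mink_self ideal_points_def)

lemma cosh_dist_hyperbolic: "cosh (dist p q) = mink (hvec p) (hvec q)"
  by (simp add: dist_hyperbolic_def mink_vec_ge_1)

lemma busemann_lipschitz:
  assumes "i \<in> ideal_points"
  shows "busemann i p - busemann i q \<le> dist p q"
proof -
  have lim: "((\<lambda>t. dist r (ideal_ray i t) - t) \<longlongrightarrow> busemann i r) at_top" for r
    using tendsto_busemann[OF assms, of r] by (simp add: busemann_eq[OF assms])
  have "dist p (ideal_ray i t) - t - (dist q (ideal_ray i t) - t) \<le> dist p q" for t
    using dist_triangle[of p "ideal_ray i t" q] by simp
  then show ?thesis
    by (intro tendsto_upperbound[OF tendsto_diff[OF lim lim]]) (auto intro: always_eventually)
qed

lemma continuous_on_busemann:
  assumes "i \<in> ideal_points"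
  shows "continuous_on S (busemann i)"
proof -
  have "\<bar>busemann i p - busemann i q\<bar> \<le> dist p q" for p q
    using busemann_lipschitz[OF assms, of p q] busemann_lipschitz[OF assms, of q p]
    by (simp add: dist_commute abs_le_iff)
  then show ?thesis
    unfolding continuous_on_iff by (metis dist_real_def order_le_less_trans)
qed

text \<open>
  The two sheets of the hyperboloid are told apart by the sign of the product with a point of the
  upper one. This decides the sheet for the flow defined next, also when it leads away from \<open>i\<close>.
\<close>

lemma timelike_future:
  assumes "mink v v = 1" "mink v (hvec p) > 0"
  shows "snd v > 0"
proof (rule ccontr)
  assume "\<not> snd v > 0"
  moreover have "(norm (fst v))\<^sup>2 < \<bar>snd v\<bar>\<^sup>2"
    using assms(1) by (simp add: mink_self)
  then have "norm (fst v) \<le> \<bar>snd v\<bar>"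
    by (meson abs_ge_zero less_imp_le power2_less_imp_less)
  ultimately have "norm (fst v) \<le> - snd v"
    by simp
  then have "norm (fst v) * norm (fst (hvec p)) \<le> - snd v * snd (hvec p)"
    using norm_less_time[of p] \<open>\<not> snd v > 0\<close> by (intro mult_mono) auto
  moreover have "- (fst v \<bullet> fst (hvec p)) \<le> norm (fst v) * norm (fst (hvec p))"
    using norm_cauchy_schwarz[of "- fst v" "fst (hvec p)"] by simp
  ultimately show False
    using assms(2) by (simp add: mink_def)
qed

text \<open>
  The point reached from \<open>p\<close> after moving by the signed distance \<open>s\<close> along the line through \<open>p\<close>
  with ideal point \<open>i\<close>, towards \<open>i\<close> if \<open>s > 0\<close> and away from it if \<open>s < 0\<close>. That line lies in the
  plane spanned by the vector of \<open>p\<close> and the null vector \<open>(i, 1)\<close>.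
\<close>

definition horo_flow :: "'a::euclidean_space \<Rightarrow> real \<Rightarrow> 'a hyperbolic \<Rightarrow> 'a hyperbolic" where
  "horo_flow i s p =
     Abs_hyperbolic (exp (- s) *\<^sub>R hvec p + (sinh s / mink (hvec p) (i, 1)) *\<^sub>R (i, 1))"

lemma hvec_horo_flow:
  assumes "i \<in> ideal_points"
  shows "hvec (horo_flow i s p)
    = exp (- s) *\<^sub>R hvec p + (sinh s / mink (hvec p) (i, 1)) *\<^sub>R (i, 1)" (is "_ = ?v")
proof -
  define m where "m = mink (hvec p) (i, 1)"
  have m: "m > 0"
    unfolding m_def by (rule mink_ideal_pos[OF assms])
  have *: "mink (i, 1) (hvec p) = m" "mink (hvec p) (i, 1) = m"
    by (simp_all add: m_def mink_commute)
  have "mink ?v ?v = 1"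
    unfolding mink_linear mink_vec_self mink_ideal_self[OF assms] * using m
    by (simp add: sinh_def exp_minus field_simps)
  moreover have "mink ?v (hvec p) = cosh s"
    unfolding mink_linear mink_vec_self * using m by (simp add: sinh_def cosh_def field_simps)
  then have "snd ?v > 0"
    using \<open>mink ?v ?v = 1\<close> by (intro timelike_future[of _ p]) (simp_all add: cosh_real_pos)
  ultimately show ?thesis
    unfolding horo_flow_def by (intro Abs_hyperbolic_inverse) simp
qed

lemma dist_horo_flow:
  assumes "i \<in> ideal_points"
  shows "dist p (horo_flow i s p) = \<bar>s\<bar>"
proof -
  have "mink (hvec p) (hvec (horo_flow i s p)) = cosh s"
    unfolding hvec_horo_flow[OF assms] mink_linear mink_vec_self
    using mink_ideal_pos[OF assms, of p] by (simp add: sinh_def cosh_def field_simps)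
  then have "dist p (horo_flow i s p) = arcosh (cosh \<bar>s\<bar>)"
    by (simp add: dist_hyperbolic_def)
  then show ?thesis
    by (simp only: arcosh_cosh_real abs_ge_zero)
qed

lemma busemann_horo_flow:
  assumes "i \<in> ideal_points"
  shows "busemann i (horo_flow i s p) = busemann i p - s"
proof -
  have "mink (hvec (horo_flow i s p)) (i, 1) = exp (- s) * mink (hvec p) (i, 1)"
    unfolding hvec_horo_flow[OF assms] mink_linear mink_ideal_self[OF assms] by simp
  then show ?thesis
    using mink_ideal_pos[OF assms, of p] by (simp add: busemann_eq[OF assms] ln_mult)
qed

lemma interior_busemann_not_extremal:
  assumes "i \<in> ideal_points" "p \<in> interior A"
  obtains q r where "q \<in> A" "busemann i q < busemann i p" "r \<in> A" "busemann i p < busemann i r"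
proof -
  obtain e where e: "e > 0" "ball p e \<subseteq> A"
    using assms(2) by (auto simp: mem_interior)
  have "horo_flow i s p \<in> A" if "\<bar>s\<bar> < e" for s
    using e(2) that dist_horo_flow[OF assms(1), of p s] by auto
  from this[of "e / 2"] this[of "- e / 2"] show ?thesis
    using e(1) by (intro that[of "horo_flow i (e / 2) p" "horo_flow i (- e / 2) p"])
      (simp_all add: busemann_horo_flow[OF assms(1)])
qed

section \<open>Horospheres as level sets\<close>

lemma busemann_level_nonempty:
  assumes "i \<in> ideal_points"
  shows "{p. busemann i p = c} \<noteq> {}"
proof -
  have "busemann i (horo_flow i (busemann i p - c) p) = c" for p
    by (simp add: busemann_horo_flow[OF assms])
  then show ?thesis
    by blast
qed

lemma interior_horoball:
  assumes "i \<in> ideal_points"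
  shows "interior {p. busemann i p \<le> c} = {p. busemann i p < c}"
proof (rule interior_unique)
  show "open {p. busemann i p < c}"
    by (intro open_Collect_less continuous_on_busemann[OF assms] continuous_on_const)
next
  fix T assume T: "T \<subseteq> {p. busemann i p \<le> c}" "open T"
  show "T \<subseteq> {p. busemann i p < c}"
  proof
    fix p assume "p \<in> T"
    then obtain r where "r \<in> T" "busemann i p < busemann i r"
      using interior_busemann_not_extremal[OF assms, of p T] T(2) by (metis interior_open)
    then show "p \<in> {p. busemann i p < c}"
      using T(1) by fastforce
  qed
qed auto

lemma frontier_horoball:
  assumes "i \<in> ideal_points"
  shows "frontier {p. busemann i p \<le> c} = {p. busemann i p = c}"
proof -
  have "closed {p. busemann i p \<le> c}"
    by (intro closed_Collect_le continuous_on_busemann[OF assms] continuous_on_const)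
  then show ?thesis
    by (auto simp: frontier_def interior_horoball[OF assms])
qed

lemma setdist_busemann_levels:
  assumes "i \<in> ideal_points" "x \<le> y"
  shows "setdist {p. busemann i p = y} {p. busemann i p = x} = y - x"
proof (rule antisym)
  obtain p where p: "busemann i p = y"
    using busemann_level_nonempty[OF assms(1)] by blast
  have "setdist {p. busemann i p = y} {p. busemann i p = x} \<le> dist p (horo_flow i (y - x) p)"
    by (rule setdist_le_dist) (simp_all add: p busemann_horo_flow[OF assms(1)])
  then show "setdist {p. busemann i p = y} {p. busemann i p = x} \<le> y - x"
    using assms(2) by (simp add: dist_horo_flow[OF assms(1)])
next
  show "y - x \<le> setdist {p. busemann i p = y} {p. busemann i p = x}"
    using busemann_level_nonempty[OF assms(1)] busemann_lipschitz[OF assms(1)]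
    by (intro le_setdistI) auto
qed

section \<open>The Fillmore width as an oscillation\<close>

text \<open>
  A level \<open>c\<close> with all of \<open>K\<close> on one side is an upper or a lower bound of the Busemann function on
  \<open>K\<close>; as it is also attained in \<open>K\<close>, it is the maximum or the minimum. Conversely, extremal
  points lie on the frontier of \<open>K\<close>.
\<close>

lemma supporting_horospheres_eq:
  assumes i: "i \<in> ideal_points" and K: "closed K"
    and p: "p \<in> K" "\<And>r. r \<in> K \<Longrightarrow> busemann i r \<le> busemann i p"
    and q: "q \<in> K" "\<And>r. r \<in> K \<Longrightarrow> busemann i q \<le> busemann i r"
  shows "supporting_horospheres K i =
    {{r. busemann i r = busemann i p}, {r. busemann i r = busemann i q}}"
proof -
  have fr: "frontier K = K - interior K"
    using K by (simp add: frontier_def)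
  have "p \<notin> interior K"
    using interior_busemann_not_extremal[OF i, of p K] p(2) by (metis linorder_not_le)
  then have pfr: "p \<in> frontier K"
    using p(1) by (simp add: fr)
  have "q \<notin> interior K"
    using interior_busemann_not_extremal[OF i, of q K] q(2) by (metis linorder_not_le)
  then have qfr: "q \<in> frontier K"
    using q(1) by (simp add: fr)
  have "(\<exists>r\<in>frontier K. busemann i r = c) \<and>
      ((\<forall>r\<in>K. busemann i r \<le> c) \<or> (\<forall>r\<in>K. c \<le> busemann i r))
      \<longleftrightarrow> c = busemann i p \<or> c = busemann i q" (is "?l \<longleftrightarrow> ?r") for c
  proof
    assume ?l
    then obtain s where s: "s \<in> K" "busemann i s = c"
        "(\<forall>r\<in>K. busemann i r \<le> c) \<or> (\<forall>r\<in>K. c \<le> busemann i r)"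
      unfolding fr by blast
    then show ?r
      using p(1) p(2)[OF s(1)] q(1) q(2)[OF s(1)] by (metis order.antisym)
  next
    assume ?r
    then show ?l
      using pfr qfr p(2) q(2) by blast
  qed
  moreover have "supporting_horospheres K i = {{r. busemann i r = c} | c.
      (\<exists>r\<in>frontier K. busemann i r = c) \<and>
      ((\<forall>r\<in>K. busemann i r \<le> c) \<or> (\<forall>r\<in>K. c \<le> busemann i r))}"
  proof -
    have 1: "{r. busemann i r = c} \<inter> frontier K \<noteq> {} \<longleftrightarrow> (\<exists>r\<in>frontier K. busemann i r = c)" for c
      by blast
    have 2: "K \<subseteq> {r. busemann i r \<le> c} \<longleftrightarrow> (\<forall>r\<in>K. busemann i r \<le> c)" for c
      by blast
    have 3: "K \<subseteq> - {r. busemann i r < c} \<longleftrightarrow> (\<forall>r\<in>K. c \<le> busemann i r)" for c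
      by (auto simp: not_less)
    have "supporting_horospheres K i = {frontier {r. busemann i r \<le> c} | c.
        frontier {r. busemann i r \<le> c} \<inter> frontier K \<noteq> {} \<and>
        (K \<subseteq> {r. busemann i r \<le> c} \<or> K \<subseteq> - interior {r. busemann i r \<le> c})}"
      unfolding supporting_horospheres_def horoball_at_def by blast
    then show ?thesis
      by (simp only: frontier_horoball[OF i] interior_horoball[OF i] 1 2 3)
  qed
  ultimately show ?thesis
    by auto
qed

lemma fillmore_width_eq:
  assumes i: "i \<in> ideal_points" and K: "compact K" "interior K \<noteq> {}"
  obtains p q where "p \<in> K" "q \<in> K" "fillmore_width K i = busemann i p - busemann i q"
    "\<And>r. r \<in> K \<Longrightarrow> busemann i r \<le> busemann i p" "\<And>r. r \<in> K \<Longrightarrow> busemann i q \<le> busemann i r"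
proof -
  obtain z where z: "z \<in> interior K"
    using K(2) by blast
  then have "K \<noteq> {}"
    using interior_subset by blast
  obtain p where p: "p \<in> K" "\<And>r. r \<in> K \<Longrightarrow> busemann i r \<le> busemann i p"
    using continuous_attains_sup[OF K(1) \<open>K \<noteq> {}\<close> continuous_on_busemann[OF i]] by blast
  obtain q where q: "q \<in> K" "\<And>r. r \<in> K \<Longrightarrow> busemann i q \<le> busemann i r"
    using continuous_attains_inf[OF K(1) \<open>K \<noteq> {}\<close> continuous_on_busemann[OF i]] by blast
  let ?H = "\<lambda>c. {r. busemann i r = c}"
  obtain r where "r \<in> K" "busemann i z < busemann i r"
    using interior_busemann_not_extremal[OF i z] by metis
  then have less: "busemann i q < busemann i p"
    using p(2)[of r] q(2)[of z] z interior_subset by fastforce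
  have ne: "?H (busemann i p) \<noteq> ?H (busemann i q)"
    using less by auto
  have supp: "supporting_horospheres K i = {?H (busemann i p), ?H (busemann i q)}"
    using supporting_horospheres_eq[OF i compact_imp_closed[OF K(1)]] p q by blast
  have sd: "setdist (?H (busemann i p)) (?H (busemann i q)) = busemann i p - busemann i q"
    using setdist_busemann_levels[OF i] less by simp
  have "fillmore_width K i = busemann i p - busemann i q"
    unfolding fillmore_width_def supp
  proof (rule the_equality)
    show "\<exists>S T. {?H (busemann i p), ?H (busemann i q)} = {S, T} \<and> S \<noteq> T \<and>
        busemann i p - busemann i q = setdist S T"
      using ne sd by metis
  next
    fix w
    assume "\<exists>S T. {?H (busemann i p), ?H (busemann i q)} = {S, T} \<and> S \<noteq> T \<and> w = setdist S T"
    then obtain S T where "{?H (busemann i p), ?H (busemann i q)} = {S, T}" "w = setdist S T"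
      by blast
    then have "w = setdist (?H (busemann i p)) (?H (busemann i q))"
      unfolding doubleton_eq_iff by (metis setdist_sym)
    then show "w = busemann i p - busemann i q"
      using sd by simp
  qed
  then show ?thesis
    using p q that by blast
qed

section \<open>The width in the direction of a diametral pair\<close>

lemma ex_ideal_point_busemann_diff:
  fixes p q :: "'a::euclidean_space hyperbolic"
  assumes "p \<noteq> q"
  obtains i where "i \<in> ideal_points" "busemann i p - busemann i q = dist p q"
proof -
  define d where "d = dist p q"
  have d: "d > 0"
    using assms by (simp add: d_def)
  have pq: "mink (hvec p) (hvec q) = cosh d" "mink (hvec q) (hvec p) = cosh d"
    using cosh_dist_hyperbolic[of p q] by (simp_all add: d_def mink_commute)
  \<comment> \<open>The plane of the line through \<open>p\<close> and \<open>q\<close> contains two null directions; \<open>v\<close> spans the one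
    towards which the line leads from \<open>p\<close> to \<open>q\<close>.\<close>
  define v where "v = 1 *\<^sub>R hvec q + (- exp (- d)) *\<^sub>R hvec p"
  note ex = cosh_def sinh_def exp_minus field_simps
  have vp: "mink (hvec p) v = sinh d"
    unfolding v_def mink_linear mink_vec_self pq by (simp add: ex)
  have vq: "mink (hvec q) v = exp (- d) * sinh d"
    unfolding v_def mink_linear mink_vec_self pq by (simp add: ex)
  have "mink v v = 0"
    unfolding v_def mink_linear mink_vec_self pq by (simp add: ex)
  then have nv: "norm (fst v) = snd v"
    using vp d by (intro null_future[of _ p]) (simp_all add: mink_commute)
  have "snd v \<noteq> 0"
  proof
    assume "snd v = 0"
    then have "v = 0"
      using nv by (simp add: prod_eq_iff)
    then show False
      using vp d by (simp add: mink_def)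
  qed
  then have pos: "snd v > 0"
    using nv norm_ge_zero[of "fst v"] by linarith
  define i where "i = fst v /\<^sub>R snd v"
  have i: "i \<in> ideal_points"
    using pos nv by (simp add: i_def ideal_points_def)
  have mi: "mink u (i, 1) = mink u v / snd v" for u
    using pos by (simp add: mink_def i_def field_simps)
  have "busemann i p - busemann i q = d"
    using pos d by (simp add: busemann_eq[OF i] mi vp vq ln_mult ln_div)
  then show ?thesis
    using i that by (simp add: d_def)
qed

theorem lemma6p2:
  fixes K :: "'a::euclidean_space hyperbolic set"
  assumes "DIM('a) \<ge> 2"
    and "convex_body K"
  shows "(\<exists>i\<in>ideal_points. fillmore_width K i = diameter K) \<and>
         (\<forall>i\<in>ideal_points. fillmore_width K i \<le> diameter K)"
proof -
  have K: "compact K" "interior K \<noteq> {}"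
    using assms(2) by (simp_all add: convex_body_def)
  have le: "fillmore_width K i \<le> diameter K" if i: "i \<in> ideal_points" for i
  proof -
    obtain p q where "p \<in> K" "q \<in> K" "fillmore_width K i = busemann i p - busemann i q"
      using fillmore_width_eq[OF i K] by metis
    then show ?thesis
      using busemann_lipschitz[OF i, of p q] diameter_bounded_bound[OF compact_imp_bounded[OF K(1)]]
      by fastforce
  qed
  have "K \<noteq> {}"
    using K(2) by auto
  then obtain p q where pq: "p \<in> K" "q \<in> K" "dist p q = diameter K"
    using diameter_compact_attained[OF K(1)] by blast
  have ge: "diameter K \<le> fillmore_width K i"
    if i: "i \<in> ideal_points" and "dist p q \<le> busemann i p - busemann i q" for i
  proof -
    obtain p' q' where "fillmore_width K i = busemann i p' - busemann i q'"
      "busemann i p \<le> busemann i p'" "busemann i q' \<le> busemann i q"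
      using fillmore_width_eq[OF i K] pq(1,2) by metis
    then show ?thesis
      using that(2) pq(3) by linarith
  qed
  have "\<exists>i\<in>ideal_points. dist p q \<le> busemann i p - busemann i q"
  proof (cases "p = q")
    case True
    obtain i :: 'a where "norm i = 1"
      using vector_choose_size[of 1] by auto
    then show ?thesis
      using True by (auto simp: ideal_points_def)
  next
    case False
    then show ?thesis
      using ex_ideal_point_busemann_diff[of p q] by (metis order_refl)
  qed
  then show ?thesis
    using le ge by (meson antisym)
qed

end
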